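(* For any positive integer $m$, there exists a graph $G$ such that, writing $d = D(G)$, one has $|\mathrm{Det}(G) - \rho_d(G)| = m$.
   Context: Graphs are finite and simple. For a graph $G$ with vertex set $V(G)$, a labeling $\phi : V(G) \to \{1,\ldots,r\}$ is $r$-distinguishing if for every non-trivial automorphism $\sigma \in \mathrm{Aut}(G)$ there is a vertex $x$ with $\phi(x) \neq \phi(\sigma x)$. The distinguishing number $D(G)$ is the least positive integer $r$ such that $G$ has an $r$-distinguishing labeling. If $D(G) = d$, the cost of $d$-distinguishing $G$, denoted $\rho_d(G)$, is the minimum size of a label class in any $d$-distinguishing labeling of $G$ (minimum over all such labelings and all $d$ label classes). A subset $S \subseteq V(G)$ is a determining set for $G$ if whenever $g,h \in \mathrm{Aut}(G)$ satisfy $g(s) = h(s)$ for all $s \in S$, then $g = h$. The determining number $\mathrm{Det}(G)$ is the minimum cardinality of a determining set of $G$. *)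

theory Defs
  imports
    "Graph_Theory.Pair_Digraph"
    "HOL-Combinatorics.Permutations"
    "HOL-Library.FuncSet"
begin

text \<open>
  A finite simple graph is a \<^locale>\<open>pair_graph\<close>: finitely many vertices, and a symmetric
  irreflexive relation \<^const>\<open>parcs\<close> on them, each undirected edge being a pair of opposite arcs.
\<close>

text \<open>
  Automorphisms are the identity outside the vertex set (\<open>permutes\<close>), so that two of them are
  equal as functions iff they agree on all vertices, and the trivial one is \<^const>\<open>id\<close>.
\<close>
definition Aut :: "'a pair_pre_digraph \<Rightarrow> ('a \<Rightarrow> 'a) set" where
  "Aut G = {\<sigma>. \<sigma> permutes pverts G \<and>
     (\<forall>u\<in>pverts G. \<forall>v\<in>pverts G. (\<sigma> u, \<sigma> v) \<in> parcs G \<longleftrightarrow> (u, v) \<in> parcs G)}"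

definition distinguishing :: "'a pair_pre_digraph \<Rightarrow> nat \<Rightarrow> ('a \<Rightarrow> nat) \<Rightarrow> bool" where
  "distinguishing G r \<phi> \<longleftrightarrow> \<phi> \<in> pverts G \<rightarrow> {1..r} \<and>
     (\<forall>\<sigma>\<in>Aut G. \<sigma> \<noteq> id \<longrightarrow> (\<exists>x\<in>pverts G. \<phi> x \<noteq> \<phi> (\<sigma> x)))"

definition distinguishing_number :: "'a pair_pre_digraph \<Rightarrow> nat" where
  "distinguishing_number G = (LEAST r. r > 0 \<and> (\<exists>\<phi>. distinguishing G r \<phi>))"

text \<open>
  The cost is meant for \<open>d = distinguishing_number G\<close>; then, on a nonempty graph, all \<open>d\<close> label
  classes are nonempty, because an unused label could be dropped.
\<close>
definition cost :: "nat \<Rightarrow> 'a pair_pre_digraph \<Rightarrow> nat" where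
  "cost d G = (LEAST k. \<exists>\<phi> i. distinguishing G d \<phi> \<and> i \<in> {1..d} \<and>
     k = card {x \<in> pverts G. \<phi> x = i})"

definition determining :: "'a pair_pre_digraph \<Rightarrow> 'a set \<Rightarrow> bool" where
  "determining G S \<longleftrightarrow> S \<subseteq> pverts G \<and>
     (\<forall>g\<in>Aut G. \<forall>h\<in>Aut G. (\<forall>s\<in>S. g s = h s) \<longrightarrow> g = h)"

definition determining_number :: "'a pair_pre_digraph \<Rightarrow> nat" where
  "determining_number G = (LEAST k. \<exists>S. determining G S \<and> k = card S)"

end

theory Submission
  imports Defs
begin

text \<open>
  The graph without edges on \<open>n = m + 2\<close> vertices has the desired property. Its automorphisms are
  all permutations of the vertices, and transpositions are what makes both invariants rigid. Two
  equally labeled vertices could be swapped, so the distinguishing labelings are exactly the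
  injective ones; hence \<open>D(G) = n\<close>, an \<open>n\<close>-distinguishing labeling is a bijection, all its label
  classes are singletons, and the cost is \<open>1\<close>. Two vertices outside a determining set could be
  swapped as well, so a determining set misses at most one vertex, and the determining number is
  \<open>n - 1\<close>. The difference is \<open>n - 2 = m\<close>.
\<close>

definition edgeless :: "'a set \<Rightarrow> 'a pair_pre_digraph" where
  "edgeless V = \<lparr>pverts = V, parcs = {}\<rparr>"

lemma pverts_edgeless [simp]: "pverts (edgeless V) = V"
  by (simp add: edgeless_def)

lemma pair_graph_edgeless:
  assumes "finite V"
  shows "pair_graph (edgeless V)"
  using assms by unfold_locales (auto simp: edgeless_def arcs_ends_def symmetric_def sym_def)

lemma Aut_edgeless: "Aut (edgeless V) = {\<sigma>. \<sigma> permutes V}"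
  by (auto simp: Aut_def edgeless_def)

text \<open>
  A label shared by two vertices is preserved by their transposition; conversely, an injective
  labeling forces every label-preserving permutation to fix each vertex.
\<close>
lemma distinguishing_edgeless_iff:
  "distinguishing (edgeless V) r \<phi> \<longleftrightarrow> \<phi> \<in> V \<rightarrow> {1..r} \<and> inj_on \<phi> V"
proof -
  have "inj_on \<phi> V" if *: "\<forall>\<sigma>. \<sigma> permutes V \<longrightarrow> \<sigma> \<noteq> id \<longrightarrow> (\<exists>x\<in>V. \<phi> x \<noteq> \<phi> (\<sigma> x))"
  proof (rule inj_onI, rule ccontr)
    fix x y
    assume xy: "x \<in> V" "y \<in> V" "\<phi> x = \<phi> y" "x \<noteq> y"
    then have "transpose x y permutes V" "transpose x y \<noteq> id"
      by (auto simp: permutes_swap_id dest!: fun_cong[of _ id x])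
    with * obtain z where "\<phi> z \<noteq> \<phi> (transpose x y z)"
      by blast
    with xy show False
      by (auto simp: transpose_def split: if_splits)
  qed
  moreover have "\<exists>x\<in>V. \<phi> x \<noteq> \<phi> (\<sigma> x)"
    if "inj_on \<phi> V" "\<sigma> permutes V" "\<sigma> \<noteq> id" for \<sigma>
  proof -
    from that obtain x where "\<sigma> x \<noteq> x"
      by fastforce
    with that have "x \<in> V" "\<sigma> x \<in> V"
      by (meson permutes_not_in permutes_in_image)+
    with \<open>\<sigma> x \<noteq> x\<close> \<open>inj_on \<phi> V\<close> show ?thesis
      by (metis inj_onD)
  qed
  ultimately show ?thesis
    unfolding distinguishing_def Aut_edgeless by auto
qed

lemma ex_distinguishing_edgeless:
  assumes "finite V"
  shows "\<exists>\<phi>. distinguishing (edgeless V) (card V) \<phi>"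
proof -
  from assms obtain \<phi> where "bij_betw \<phi> V {1..card V}"
    using finite_same_card_bij[of V "{1..card V}"] by auto
  then have "distinguishing (edgeless V) (card V) \<phi>"
    unfolding distinguishing_edgeless_iff by (auto simp: bij_betw_def)
  then show ?thesis
    by blast
qed

lemma distinguishing_number_edgeless:
  assumes "finite V" "V \<noteq> {}"
  shows "distinguishing_number (edgeless V) = card V"
  unfolding distinguishing_number_def
proof (rule Least_equality)
  show "0 < card V \<and> (\<exists>\<phi>. distinguishing (edgeless V) (card V) \<phi>)"
    using assms ex_distinguishing_edgeless by (auto simp: card_gt_0_iff)
next
  fix r
  assume "0 < r \<and> (\<exists>\<phi>. distinguishing (edgeless V) r \<phi>)"
  then obtain \<phi> where "inj_on \<phi> V" "\<phi> ` V \<subseteq> {1..r}"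
    by (auto simp: distinguishing_edgeless_iff)
  then show "card V \<le> r"
    using card_inj_on_le[of \<phi> V "{1..r}"] by simp
qed

text \<open>
  With as many labels as vertices, an injective labeling uses each label exactly once.
\<close>
lemma card_label_class_edgeless:
  assumes "finite V" "distinguishing (edgeless V) (card V) \<phi>" "i \<in> {1..card V}"
  shows "card {x \<in> V. \<phi> x = i} = 1"
proof -
  from assms have inj: "inj_on \<phi> V" and "\<phi> ` V \<subseteq> {1..card V}"
    by (auto simp: distinguishing_edgeless_iff)
  then have "\<phi> ` V = {1..card V}"
    by (simp add: card_image card_subset_eq)
  with assms obtain x where "x \<in> V" "\<phi> x = i"
    by (metis imageE)
  with inj have "{x \<in> V. \<phi> x = i} = {x}"
    by (auto dest: inj_onD)
  then show ?thesis
    by simp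
qed

lemma cost_edgeless:
  assumes "finite V" "V \<noteq> {}"
  shows "cost (card V) (edgeless V) = 1"
  unfolding cost_def
proof (rule Least_equality)
  obtain \<phi> where "distinguishing (edgeless V) (card V) \<phi>"
    using assms ex_distinguishing_edgeless by blast
  moreover have "1 \<in> {1..card V}"
    using assms by (simp add: Suc_le_eq card_gt_0_iff)
  ultimately show "\<exists>\<phi> i. distinguishing (edgeless V) (card V) \<phi> \<and> i \<in> {1..card V} \<and>
      1 = card {x \<in> pverts (edgeless V). \<phi> x = i}"
    using assms card_label_class_edgeless by (metis pverts_edgeless)
next
  fix k
  assume "\<exists>\<phi> i. distinguishing (edgeless V) (card V) \<phi> \<and> i \<in> {1..card V} \<and>
      k = card {x \<in> pverts (edgeless V). \<phi> x = i}"
  then show "1 \<le> k"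
    using assms card_label_class_edgeless by fastforce
qed

text \<open>
  The transposition of two vertices outside \<open>S\<close> agrees with the identity on \<open>S\<close>. If instead only
  one vertex \<open>x\<close> is missing, then two permutations that agree off \<open>x\<close> agree at \<open>x\<close> as well, because
  \<open>x\<close> must go to the only value that is left over.
\<close>
lemma determining_edgeless_iff:
  "determining (edgeless V) S \<longleftrightarrow> S \<subseteq> V \<and> (\<forall>x\<in>V - S. \<forall>y\<in>V - S. x = y)"
proof -
  have "x = y"
    if *: "\<forall>g. g permutes V \<longrightarrow> (\<forall>h. h permutes V \<longrightarrow> (\<forall>s\<in>S. g s = h s) \<longrightarrow> g = h)"
      and xy: "x \<in> V - S" "y \<in> V - S" for x y
  proof -
    have "transpose x y permutes V" "\<forall>s\<in>S. transpose x y s = id s"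
      using xy by (auto simp: permutes_swap_id transpose_def)
    with * have "transpose x y = id"
      using permutes_id by blast
    then show "x = y"
      by (metis id_apply transpose_apply_first)
  qed
  moreover have "g = h"
    if one: "\<forall>x\<in>V - S. \<forall>y\<in>V - S. x = y"
      and g: "g permutes V" and h: "h permutes V" and eq: "\<forall>s\<in>S. g s = h s" for g h
  proof
    fix x
    show "g x = h x"
    proof (cases "x \<in> V - S")
      case True
      obtain y where y: "h y = g x"
        using h by (metis permutes_surj surjD)
      have "y \<in> V"
        using True g h y by (metis DiffD1 permutes_in_image)
      have "y = x"
      proof (cases "y \<in> S")
        case True
        then have "g y = g x"
          using eq y by simp
        then show ?thesis
          using permutes_inj[OF g] by (simp add: inj_eq)
      next
        case False
        then show ?thesis
          using one True \<open>y \<in> V\<close> by blast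
      qed
      with y show ?thesis
        by simp
    next
      case False
      then show ?thesis
        using eq g h by (metis DiffI permutes_not_in)
    qed
  qed
  ultimately show ?thesis
    unfolding determining_def Aut_edgeless by auto
qed

lemma determining_number_edgeless:
  assumes "finite V" "V \<noteq> {}"
  shows "determining_number (edgeless V) = card V - 1"
  unfolding determining_number_def
proof (rule Least_equality)
  obtain x where "x \<in> V"
    using assms by blast
  then have "determining (edgeless V) (V - {x})" "card V - 1 = card (V - {x})"
    using assms by (auto simp: determining_edgeless_iff)
  then show "\<exists>S. determining (edgeless V) S \<and> card V - 1 = card S"
    by blast
next
  fix k
  assume "\<exists>S. determining (edgeless V) S \<and> k = card S"
  then obtain S where S: "S \<subseteq> V" "\<forall>x\<in>V - S. \<forall>y\<in>V - S. x = y" "k = card S"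
    by (auto simp: determining_edgeless_iff)
  then have "card (V - S) \<le> 1"
    using assms by (auto simp: card_le_Suc0_iff_eq)
  then show "card V - 1 \<le> k"
    using assms S by (simp add: card_Diff_subset finite_subset)
qed

theorem theorem2p12:
  fixes m :: nat
  assumes "m > 0"
  shows "\<exists>G :: nat pair_pre_digraph. pair_graph G \<and>
    (\<exists>d. d = distinguishing_number G \<and>
      \<bar>int (determining_number G) - int (cost d G)\<bar> = int m)"
proof -
  define V :: "nat set" where "V = {..<m + 2}"
  have V: "finite V" "V \<noteq> {}" "card V = m + 2"
    by (auto simp: V_def lessThan_empty_iff)
  have "determining_number (edgeless V) = m + 1"
    using determining_number_edgeless[OF V(1,2)] V(3) by simp
  then have "\<bar>int (determining_number (edgeless V)) - int (cost (card V) (edgeless V))\<bar> = int m"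
    by (simp only: cost_edgeless[OF V(1,2)])
  then show ?thesis
    using pair_graph_edgeless[OF V(1)] distinguishing_number_edgeless[OF V(1,2)] by metis
qed

end
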